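(* For every integer $n\ge 1$, $$\mathrm{pf}_n(132,213,231)=\mathrm{pf}_n(132,231,312)=\sum_{i=1}^n C_i,$$ where $C_i=\frac{1}{i+1}\binom{2i}{i}$ is the $i$th Catalan number.
   Context: A Dyck path of semilength $n$ is a lattice path from $(0,0)$ to $(n,n)$ consisting of $n$ north steps $N=(0,1)$ and $n$ east steps $E=(1,0)$ that never goes below the line $y=x$. A parking function of size $n$ is a Dyck path of semilength $n$ whose $n$ north steps are labeled bijectively by $\{1,\dots,n\}$ so that whenever two north steps are consecutive in the path (one immediately following the other), the label of the later one is larger. For a parking function $p$ of size $n$, $\phi(p)$ is the permutation of $\{1,\dots,n\}$ (in one-line notation) obtained by reading the labels of the north steps in the order they occur along the path. A permutation $\pi$ of $\{1,\dots,n\}$ contains a permutation $\rho$ of $\{1,\dots,m\}$ if there are indices $1\le i_1<\cdots<i_m\le n$ such that $\pi_{i_a}\le\pi_{i_b}$ if and only if $\rho_a\le\rho_b$; otherwise $\pi$ avoids $\rho$. For permutations $\rho_1,\dots,\rho_r$, $\mathrm{pf}_n(\rho_1,\dots,\rho_r)$ denotes the number of parking functions $p$ of size $n$ such that $\phi(p)$ avoids each of $\rho_1,\dots,\rho_r$. *)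

theory Defs
  imports Complex_Main "HOL-Combinatorics.Multiset_Permutations"
begin

text \<open>
  A lattice path is a list of steps. North steps carry a label, so that an element of
  \<open>'l step list\<close> is a lattice path together with a labelling of its north steps
  (take \<open>unit\<close> for \<open>'l\<close> to get unlabelled paths).
\<close>

datatype 'l step = North 'l | East

fun north_labels :: "'l step list \<Rightarrow> 'l list" where
  "north_labels [] = []"
| "north_labels (North l # w) = l # north_labels w"
| "north_labels (East # w) = north_labels w"

text \<open>The lattice point reached from the origin by following the steps.\<close>

fun endpoint :: "'l step list \<Rightarrow> nat \<times> nat" where
  "endpoint [] = (0, 0)"
| "endpoint (North l # w) = (fst (endpoint w), Suc (snd (endpoint w)))"
| "endpoint (East # w) = (Suc (fst (endpoint w)), snd (endpoint w))"

text \<open>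
  The labels play no role here. Each step is a unit segment between lattice points, so the
  path stays weakly above the line \<open>y = x\<close> iff all the lattice points it visits do.
\<close>

definition dyck_path :: "nat \<Rightarrow> 'l step list \<Rightarrow> bool" where
  "dyck_path n w \<longleftrightarrow>
     endpoint w = (n, n) \<and>
     (\<forall>k \<le> length w. fst (endpoint (take k w)) \<le> snd (endpoint (take k w)))"

text \<open>
  The north steps are labelled bijectively by \<open>{1..n}\<close> iff the list of labels, read along
  the path, is an enumeration of \<open>{1..n}\<close> without repetitions.
\<close>

definition parking_functions :: "nat \<Rightarrow> nat step list set" where
  "parking_functions n = {p.
     dyck_path n p \<and>
     north_labels p \<in> permutations_of_set {1..n} \<and>
     (\<forall>i a b. Suc i < length p \<and> p ! i = North a \<and> p ! Suc i = North b \<longrightarrow> a < b)}"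

definition phi :: "nat step list \<Rightarrow> nat list" where
  "phi p = north_labels p"

text \<open>Permutations are lists in one-line notation; positions count from 0, values from 1.\<close>

definition contains_pattern :: "nat list \<Rightarrow> nat list \<Rightarrow> bool" where
  "contains_pattern \<pi> \<rho> \<longleftrightarrow>
     (\<exists>f :: nat \<Rightarrow> nat.
        strict_mono_on {..<length \<rho>} f \<and>
        f ` {..<length \<rho>} \<subseteq> {..<length \<pi>} \<and>
        (\<forall>a < length \<rho>. \<forall>b < length \<rho>. \<pi> ! f a \<le> \<pi> ! f b \<longleftrightarrow> \<rho> ! a \<le> \<rho> ! b))"

definition avoids :: "nat list \<Rightarrow> nat list \<Rightarrow> bool" where
  "avoids \<pi> \<rho> \<longleftrightarrow> \<not> contains_pattern \<pi> \<rho>"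

definition pf :: "nat \<Rightarrow> nat list set \<Rightarrow> nat" where
  "pf n R = card {p \<in> parking_functions n. \<forall>\<rho> \<in> R. avoids (phi p) \<rho>}"

definition catalan :: "nat \<Rightarrow> real" where
  "catalan i = 1 / (real i + 1) * real ((2 * i) choose i)"

end

theory Submission
  imports Defs
begin

text \<open>
  In either case the avoiding permutations decrease up to the letter 1 and increase afterwards,
  and there is exactly one for each length of the decreasing part. Every descent between
  consecutive labels forces an east step, so over the decreasing part the path is confined to
  the diagonal, of the form \<open>(NE)\<^sup>k\<close>. On the increasing part the labels impose no condition,
  so an arbitrary Dyck path of the remaining semilength follows.
\<close>

section \<open>Counting the parking functions with a given label word\<close>

text \<open>\<open>h\<close> is the current height above the diagonal. Allowing any starting height
  makes the Dyck condition recursive in the first step.\<close>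

fun ballot :: "nat \<Rightarrow> 'l step list \<Rightarrow> bool" where
  "ballot h [] \<longleftrightarrow> h = 0"
| "ballot h (North l # w) \<longleftrightarrow> ballot (Suc h) w"
| "ballot h (East # w) \<longleftrightarrow> h > 0 \<and> ballot (h - 1) w"

lemma snd_endpoint: "snd (endpoint w) = length (north_labels w)"
  by (induction w rule: north_labels.induct) auto

lemma all_le_Suc_conv: "(\<forall>k \<le> Suc n. P k) \<longleftrightarrow> P 0 \<and> (\<forall>k \<le> n. P (Suc k))"
  by (metis Suc_le_mono le0 not0_implies_Suc)

lemma ballot_iff_endpoint:
  "ballot h w \<longleftrightarrow> fst (endpoint w) = h + snd (endpoint w) \<and>
     (\<forall>k \<le> length w. fst (endpoint (take k w)) \<le> h + snd (endpoint (take k w)))"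
proof (induction h w rule: ballot.induct)
  case (3 h w)
  show ?case
  proof (cases h)
    case 0
    have "\<not> fst (endpoint (take 1 (East # w))) \<le> 0 + snd (endpoint (take 1 (East # w)))"
      by simp
    moreover have "1 \<le> length (East # w)" by simp
    ultimately show ?thesis using 0 by (metis ballot.simps(3) less_irrefl)
  next
    case (Suc g)
    then show ?thesis using 3 by (auto simp: all_le_Suc_conv)
  qed
qed (auto simp: all_le_Suc_conv)

lemma dyck_path_iff_ballot:
  "dyck_path n w \<longleftrightarrow> ballot 0 w \<and> length (north_labels w) = n"
  unfolding dyck_path_def ballot_iff_endpoint snd_endpoint [symmetric]
  by (cases "endpoint w") auto

definition north_ascent :: "nat step \<Rightarrow> nat step \<Rightarrow> bool" where
  "north_ascent s t \<longleftrightarrow> (\<forall>a b. s = North a \<and> t = North b \<longrightarrow> a < b)"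

lemma north_ascent_simps [simp]:
  "north_ascent (North a) (North b) \<longleftrightarrow> a < b"
  "north_ascent East t" "north_ascent s East"
  by (auto simp: north_ascent_def)

text \<open>For \<open>h = 0\<close> and \<open>L\<close> a permutation of \<open>{1..n}\<close>
  this is the fibre of \<open>phi\<close> over \<open>L\<close>; general \<open>h\<close> serves the
  recursion on the first step.\<close>

definition labelled_paths :: "nat \<Rightarrow> nat list \<Rightarrow> nat step list set" where
  "labelled_paths h L = {p. ballot h p \<and> successively north_ascent p \<and> north_labels p = L}"

lemma parking_functions_eq:
  "parking_functions n = {p. phi p \<in> permutations_of_set {1..n} \<and> p \<in> labelled_paths 0 (phi p)}"
proof -
  have "length L = n" if "L \<in> permutations_of_set {1..n}" for L
    using length_finite_permutations_of_set[OF that] by simp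
  then show ?thesis
    unfolding parking_functions_def labelled_paths_def phi_def dyck_path_iff_ballot
      successively_conv_nth north_ascent_def by blast
qed

lemma labelled_paths_Nil: "labelled_paths h [] = {replicate h East}"
proof -
  have "ballot h p \<and> north_labels p = [] \<longleftrightarrow> p = replicate h East" for p :: "nat step list"
    by (induction h p rule: ballot.induct) (auto simp: gr0_conv_Suc Cons_replicate_eq)
  moreover have "successively north_ascent (replicate h East)"
    by (simp add: successively_conv_nth)
  ultimately show ?thesis unfolding labelled_paths_def by blast
qed

text \<open>Splits by the first step. If a North step follows the one labelled \<open>x\<close>, its
  label is the head of \<open>L\<close> and hence exceeds \<open>x\<close>, so the ascent condition
  excludes nothing.\<close>

lemma labelled_paths_Cons:
  assumes "sorted_wrt (<) (x # L)"
  shows "labelled_paths h (x # L) = (#) (North x) ` labelled_paths (Suc h) L \<union>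
           (if h = 0 then {} else (#) East ` labelled_paths (h - 1) (x # L))"
    (is "_ = ?R")
proof (rule set_eqI)
  fix p
  show "p \<in> labelled_paths h (x # L) \<longleftrightarrow> p \<in> ?R"
  proof (cases p)
    case Nil
    then show ?thesis by (auto simp: labelled_paths_def)
  next
    case (Cons s w)
    have "w \<noteq> [] \<Longrightarrow> north_labels w = L \<Longrightarrow> north_ascent (North x) (hd w)"
      using assms by (cases w rule: north_labels.cases) auto
    then show ?thesis
      using Cons by (cases s) (auto simp: labelled_paths_def successively_Cons)
  qed
qed

text \<open>
  For increasing labels only the path matters, and the count is the ballot number
  given by the reflection principle. The case distinction stands for the binomial
  coefficient with lower index \<open>- 1\<close>.
\<close>

lemma card_labelled_paths_sorted:
  assumes "sorted_wrt (<) L"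
  shows "finite (labelled_paths h L) \<and>
    real (card (labelled_paths h L)) = real ((2 * length L + h) choose length L)
      - (if L = [] then 0 else real ((2 * length L + h) choose (length L - 1)))"
  using assms
proof (induction L arbitrary: h)
  case Nil
  then show ?case by (simp add: labelled_paths_Nil)
next
  case (Cons x L)
  let ?m = "length L"
  have IH: "finite (labelled_paths h L)"
    "real (card (labelled_paths h L)) = real ((2 * ?m + h) choose ?m)
      - (if L = [] then 0 else real ((2 * ?m + h) choose (?m - 1)))" for h
    using Cons by auto
  have pascal: "real (Suc (Suc (2 * ?m + h)) choose Suc ?m) =
      real (Suc (2 * ?m + h) choose Suc ?m) + real (Suc (2 * ?m + h) choose ?m)" for h
    by simp
  have pascal': "real (Suc (Suc (2 * ?m + h)) choose ?m) =
      real (Suc (2 * ?m + h) choose ?m)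
      + (if L = [] then 0 else real (Suc (2 * ?m + h) choose (?m - 1)))" for h
    by (cases L) auto
  show ?case
  \<comment> \<open>A first step East lowers \<open>h\<close> but keeps all labels, hence an inner
    induction on \<open>h\<close>. The recursion is Pascal's rule for each of the two
    binomials.\<close>
  proof (induction h)
    case 0
    have "card (labelled_paths 0 (x # L)) = card (labelled_paths 1 L)"
      using labelled_paths_Cons[OF Cons.prems, of 0] by (simp add: card_image)
    \<comment> \<open>At height zero no path starts East; the symmetry of an odd row of Pascal's
      triangle makes up for that missing summand.\<close>
    moreover have "(Suc (2 * ?m) choose Suc ?m) = (Suc (2 * ?m) choose ?m)"
      using binomial_symmetric[of ?m "Suc (2 * ?m)"] by (simp add: Suc_diff_le)
    ultimately show ?case
      using IH[of 1] pascal[of 0] pascal'[of 0] labelled_paths_Cons[OF Cons.prems, of 0]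
      by simp
  next
    case (Suc h)
    have eq: "labelled_paths (Suc h) (x # L) = (#) (North x) ` labelled_paths (Suc (Suc h)) L
        \<union> (#) East ` labelled_paths h (x # L)"
      using labelled_paths_Cons[OF Cons.prems, of "Suc h"] by simp
    have "card (labelled_paths (Suc h) (x # L)) =
        card (labelled_paths (Suc (Suc h)) L) + card (labelled_paths h (x # L))"
      unfolding eq using Suc IH by (subst card_Un_disjoint) (auto simp: card_image)
    then show ?case
      using IH[of "Suc (Suc h)"] pascal[of "Suc h"] pascal'[of "Suc h"] Suc eq by simp
  qed
qed

text \<open>The two binomials are in the ratio (m + 2) : (m + 1), so their difference is the first
  one divided by m + 2.\<close>

lemma catalan_eq_diff:
  "catalan (Suc m) = real ((2 * Suc m) choose Suc m) - real ((2 * Suc m) choose m)"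
proof -
  let ?A = "(2 * Suc m) choose Suc m" and ?B = "(2 * Suc m) choose m"
  have "Suc m * ?A = Suc (Suc m) * ?B"
    using Suc_times_binomial_add[of m "Suc m"] by (simp add: mult_2)
  then have "(real m + 1) * real ?A = (real m + 2) * real ?B"
    by (metis add.commute add_2_eq_Suc' of_nat_Suc of_nat_add of_nat_mult of_nat_numeral)
  then show ?thesis
    unfolding catalan_def by (simp add: field_simps del: binomial_Suc_Suc)
qed

text \<open>At height zero a descent in the labels forces the steps North, East.\<close>

lemma labelled_paths_descent:
  assumes "b < a"
  shows "labelled_paths 0 (a # b # L) = (\<lambda>w. North a # East # w) ` labelled_paths 0 (b # L)"
    (is "_ = ?R")
proof (rule set_eqI)
  fix p
  show "p \<in> labelled_paths 0 (a # b # L) \<longleftrightarrow> p \<in> ?R"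
  proof (cases p)
    case Nil
    then show ?thesis by (auto simp: labelled_paths_def)
  next
    case (Cons s w)
    \<comment> \<open>The path cannot start East at height zero, and a second step North would carry
      \<open>b < a\<close> right after \<open>a\<close>; the East step then returns to height
      zero.\<close>
    show ?thesis
      unfolding Cons using assms
      by (cases s; cases w rule: north_labels.cases)
        (auto simp: labelled_paths_def successively_Cons)
  qed
qed

text \<open>Each letter of \<open>ds\<close> exceeds its successor and so contributes only a forced
  North, East; the choice lies in the path over the increasing word \<open>x # L\<close>.\<close>

lemma card_labelled_paths_valley:
  assumes "sorted_wrt (>) (ds @ [x])" "sorted_wrt (<) (x # L)"
  shows "finite (labelled_paths 0 (ds @ x # L)) \<and>
    real (card (labelled_paths 0 (ds @ x # L))) = catalan (Suc (length L))"
  using assms(1)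
proof (induction ds)
  case Nil
  show ?case
    using card_labelled_paths_sorted[OF assms(2), of 0] by (simp add: catalan_eq_diff)
next
  case (Cons d ds)
  obtain b M where bM: "ds @ x # L = b # M" by (cases ds) auto
  have "b < d" using Cons.prems bM by (cases ds) auto
  then show ?case
    using Cons bM by (simp add: labelled_paths_descent card_image inj_on_def)
qed

text \<open>Summation over the fibres of \<open>phi\<close>: \<open>f\<close> enumerates the
  avoiding permutations without repetition, and \<open>c k\<close> is the Catalan index of the fibre
  over \<open>f k\<close>.\<close>

lemma pf_eq_sum_catalan:
  assumes perms: "\<And>\<pi>. \<pi> \<in> permutations_of_set {1..n} \<Longrightarrow>
      (\<forall>\<rho>\<in>R. avoids \<pi> \<rho>) \<longleftrightarrow> \<pi> \<in> f ` K"
    and f: "\<And>k. k \<in> K \<Longrightarrow> f k \<in> permutations_of_set {1..n}"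
    and inj: "inj_on f K" and "finite K"
    and card: "\<And>k. k \<in> K \<Longrightarrow> finite (labelled_paths 0 (f k)) \<and>
      real (card (labelled_paths 0 (f k))) = catalan (c k)"
  shows "real (pf n R) = (\<Sum>k\<in>K. catalan (c k))"
proof -
  have "{p \<in> parking_functions n. \<forall>\<rho>\<in>R. avoids (phi p) \<rho>} = (\<Union>k\<in>K. labelled_paths 0 (f k))"
    (is "?A = ?B")
  proof
    show "?A \<subseteq> ?B"
    proof
      fix p assume "p \<in> ?A"
      then have "p \<in> labelled_paths 0 (phi p)" "phi p \<in> f ` K"
        using perms unfolding parking_functions_eq by blast+
      then show "p \<in> ?B" by auto
    qed
    show "?B \<subseteq> ?A"
    proof
      fix p assume "p \<in> ?B"
      then obtain k where k: "k \<in> K" "p \<in> labelled_paths 0 (f k)" by blast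
      then have "phi p = f k" by (simp add: labelled_paths_def phi_def)
      then show "p \<in> ?A" using k f perms unfolding parking_functions_eq by auto
    qed
  qed
  moreover have "labelled_paths 0 (f j) \<inter> labelled_paths 0 (f k) = {}"
    if "j \<in> K" "k \<in> K" "j \<noteq> k" for j k
    using inj that by (auto simp: labelled_paths_def inj_on_def)
  ultimately have "pf n R = (\<Sum>k\<in>K. card (labelled_paths 0 (f k)))"
    unfolding pf_def using \<open>finite K\<close> card by (simp add: card_UN_disjoint)
  then show ?thesis using card by simp
qed

section \<open>Permutations avoiding three patterns of length three\<close>

lemma contains_pattern_3:
  "contains_pattern \<pi> [a, b, c] \<longleftrightarrow>
     (\<exists>i j k. i < j \<and> j < k \<and> k < length \<pi> \<and>
        (\<pi> ! i \<le> \<pi> ! j \<longleftrightarrow> a \<le> b) \<and> (\<pi> ! j \<le> \<pi> ! i \<longleftrightarrow> b \<le> a) \<and>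
        (\<pi> ! i \<le> \<pi> ! k \<longleftrightarrow> a \<le> c) \<and> (\<pi> ! k \<le> \<pi> ! i \<longleftrightarrow> c \<le> a) \<and>
        (\<pi> ! j \<le> \<pi> ! k \<longleftrightarrow> b \<le> c) \<and> (\<pi> ! k \<le> \<pi> ! j \<longleftrightarrow> c \<le> b))"
    (is "?L \<longleftrightarrow> (\<exists>i j k. ?P i j k)")
proof
  have lt3: "(\<forall>m < length [a, b, c]. Q m) \<longleftrightarrow> Q 0 \<and> Q 1 \<and> Q 2" for Q
    by (auto simp: less_Suc_eq numeral_2_eq_2)
  {
    assume ?L
    then obtain f where f: "strict_mono_on {..<length [a, b, c]} f"
      "f ` {..<length [a, b, c]} \<subseteq> {..<length \<pi>}"
      "\<forall>s < length [a, b, c]. \<forall>t < length [a, b, c].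
         \<pi> ! f s \<le> \<pi> ! f t \<longleftrightarrow> [a, b, c] ! s \<le> [a, b, c] ! t"
      unfolding contains_pattern_def by blast
    have "f 0 < f 1" "f 1 < f 2" using f(1) by (auto simp: strict_mono_on_def)
    moreover have "f 2 < length \<pi>" using f(2) by (auto simp: image_subset_iff)
    ultimately have "?P (f 0) (f 1) (f 2)"
      using f(3) unfolding lt3 by simp
    then show "\<exists>i j k. ?P i j k" by blast
  }
  {
    assume "\<exists>i j k. ?P i j k"
    then obtain i j k where ijk: "?P i j k" by blast
    define f where "f = (!) [i, j, k]"
    have "strict_mono_on {..<length [a, b, c]} f"
      using ijk by (auto simp: f_def strict_mono_on_def less_Suc_eq numeral_3_eq_3)
    moreover have "f ` {..<length [a, b, c]} \<subseteq> {..<length \<pi>}"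
      using ijk by (auto simp: f_def less_Suc_eq numeral_3_eq_3)
    moreover have "\<forall>s < length [a, b, c]. \<forall>t < length [a, b, c].
         \<pi> ! f s \<le> \<pi> ! f t \<longleftrightarrow> [a, b, c] ! s \<le> [a, b, c] ! t"
      unfolding lt3 using ijk by (simp add: f_def)
    ultimately show ?L unfolding contains_pattern_def by blast
  }
qed

lemma contains_pattern_Cons:
  assumes "contains_pattern \<pi> [a, b, c]"
  shows "contains_pattern (x # \<pi>) [a, b, c]"
proof -
  obtain i j k where "i < j \<and> j < k \<and> k < length \<pi> \<and>
        (\<pi> ! i \<le> \<pi> ! j \<longleftrightarrow> a \<le> b) \<and> (\<pi> ! j \<le> \<pi> ! i \<longleftrightarrow> b \<le> a) \<and>
        (\<pi> ! i \<le> \<pi> ! k \<longleftrightarrow> a \<le> c) \<and> (\<pi> ! k \<le> \<pi> ! i \<longleftrightarrow> c \<le> a) \<and>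
        (\<pi> ! j \<le> \<pi> ! k \<longleftrightarrow> b \<le> c) \<and> (\<pi> ! k \<le> \<pi> ! j \<longleftrightarrow> c \<le> b)"
    using assms unfolding contains_pattern_3 by blast
  then show ?thesis
    unfolding contains_pattern_3
    by (intro exI[of _ "Suc i"] exI[of _ "Suc j"] exI[of _ "Suc k"]) simp
qed

text \<open>Letting the first letter play the first entry of the pattern turns avoidance into a
  condition on pairs of later letters.\<close>

lemma avoids_Cons_sorted_wrt:
  assumes "avoids (x # xs) [a, b, c]"
  shows "sorted_wrt (\<lambda>y z. \<not> ((x \<le> y \<longleftrightarrow> a \<le> b) \<and> (y \<le> x \<longleftrightarrow> b \<le> a) \<and>
           (x \<le> z \<longleftrightarrow> a \<le> c) \<and> (z \<le> x \<longleftrightarrow> c \<le> a) \<and>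
           (y \<le> z \<longleftrightarrow> b \<le> c) \<and> (z \<le> y \<longleftrightarrow> c \<le> b))) xs"
  unfolding sorted_wrt_iff_nth_less
proof (intro allI impI notI, goal_cases)
  case (1 i j)
  then have "contains_pattern (x # xs) [a, b, c]"
    unfolding contains_pattern_3
    by (intro exI[of _ "0::nat"] exI[of _ "Suc i"] exI[of _ "Suc j"]) simp
  then show False using assms by (simp add: avoids_def)
qed

lemma
  shows avoids_132_Cons: "avoids (x # xs) [1,3,2] \<Longrightarrow> sorted_wrt (\<lambda>y z. \<not> (x < z \<and> z < y)) xs"
    and avoids_213_Cons: "avoids (x # xs) [2,1,3] \<Longrightarrow> sorted_wrt (\<lambda>y z. \<not> (y < x \<and> x < z)) xs"
    and avoids_231_Cons: "avoids (x # xs) [2,3,1] \<Longrightarrow> sorted_wrt (\<lambda>y z. \<not> (z < x \<and> x < y)) xs"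
    and avoids_312_Cons: "avoids (x # xs) [3,1,2] \<Longrightarrow> sorted_wrt (\<lambda>y z. \<not> (y < z \<and> z < x)) xs"
  by (drule avoids_Cons_sorted_wrt, erule sorted_wrt_mono_rel[rotated], fastforce)+

text \<open>The letters after the first letter \<open>x\<close> lie all below it or all above it. In
  the first case \<open>x = n\<close> and induction handles the rest; in the second the word is
  increasing.\<close>

lemma avoids_132_213_231_iff:
  assumes "\<pi> \<in> permutations_of_set {1..n}" "n \<ge> 1"
  shows "(\<forall>\<rho>\<in>{[1,3,2], [2,1,3], [2,3,1]}. avoids \<pi> \<rho>) \<longleftrightarrow>
    \<pi> \<in> (\<lambda>j. rev [Suc j..<Suc n] @ [1..<Suc j]) ` {1..n}"
proof
  assume "\<pi> \<in> (\<lambda>j. rev [Suc j..<Suc n] @ [1..<Suc j]) ` {1..n}"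
  then obtain j where j: "j \<in> {1..n}" "\<pi> = rev [Suc j..<Suc n] @ [1..<Suc j]" by blast
  have "\<pi> ! i = (if i < n - j then n - i else Suc i - (n - j))" if "i < n" for i
    using that j by (auto simp: nth_append rev_nth simp del: upt_Suc)
  then have "\<not> (\<pi> ! i < \<pi> ! k \<and> \<pi> ! k < \<pi> ! j)" "\<not> (\<pi> ! j < \<pi> ! i \<and> \<pi> ! i < \<pi> ! k)"
    "\<not> (\<pi> ! k < \<pi> ! i \<and> \<pi> ! i < \<pi> ! j)" if "i < j" "j < k" "k < n" for i j k
    using that by auto
  moreover have "length \<pi> = n" using j by simp
  ultimately show "\<forall>\<rho>\<in>{[1,3,2], [2,1,3], [2,3,1]}. avoids \<pi> \<rho>"
    by (auto simp: avoids_def contains_pattern_3 not_le)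
next
  assume "\<forall>\<rho>\<in>{[1,3,2], [2,1,3], [2,3,1]}. avoids \<pi> \<rho>"
  then show "\<pi> \<in> (\<lambda>j. rev [Suc j..<Suc n] @ [1..<Suc j]) ` {1..n}"
    using assms
  proof (induction \<pi> arbitrary: n)
    case Nil
    then show ?case by (auto simp: permutations_of_set_def)
  next
    case (Cons x xs)
    have perm: "insert x (set xs) = {1..n}" "x \<notin> set xs" "distinct xs"
      using Cons.prems by (auto simp: permutations_of_set_def)
    \<comment> \<open>Avoiding 213 and 231 keeps two later letters on the same side of
      \<open>x\<close>; avoiding 132 makes those above \<open>x\<close> increase.\<close>
    have rel: "sorted_wrt (\<lambda>y z. x < y \<and> y \<le> z \<or> y \<le> x \<and> z \<le> x) xs"
    proof -
      have "sorted_wrt (\<lambda>y z. \<not> (x < z \<and> z < y)) xs" "sorted_wrt (\<lambda>y z. \<not> (y < x \<and> x < z)) xs"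
        "sorted_wrt (\<lambda>y z. \<not> (z < x \<and> x < y)) xs"
        using Cons.prems(1) by (blast intro: avoids_132_Cons avoids_213_Cons avoids_231_Cons)+
      moreover have "xs ! i \<noteq> x" if "i < length xs" for i
        using perm(2) that by auto
      ultimately show ?thesis
        unfolding sorted_wrt_iff_nth_less by (metis linorder_not_less linorder_neqE_nat
            order_less_imp_le order_less_trans)
    qed
    show ?case
    proof (cases "\<forall>y\<in>set xs. y < x")
      case True
      have "n \<in> insert x (set xs)" "x \<in> {1..n}"
        using perm(1) Cons.prems(3) by (simp, blast)
      then have "x = n" using True by auto
      have "set xs = {1..n} - {x}" using perm(1,2) by (metis Diff_insert_absorb)
      also have "\<dots> = {1..n - 1}" unfolding \<open>x = n\<close> by auto
      finally have set_xs: "set xs = {1..n - 1}" .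
      show ?thesis
      \<comment> \<open>For \<open>n = 1\<close> the rest is empty and the induction hypothesis,
        which needs \<open>n - 1 \<ge> 1\<close>, does not apply.\<close>
      proof (cases "n = 1")
        case True
        then show ?thesis using set_xs \<open>x = n\<close> by simp
      next
        case False
        have "\<forall>\<rho>\<in>{[1,3,2], [2,1,3], [2,3,1]}. avoids xs \<rho>"
          using Cons.prems(1) contains_pattern_Cons by (auto simp: avoids_def)
        moreover have "xs \<in> permutations_of_set {1..n - 1}"
          using set_xs perm by (simp add: permutations_of_set_def)
        moreover have "n - 1 \<ge> 1" using False Cons.prems(3) by simp
        ultimately obtain j where j: "j \<in> {1..n - 1}" "xs = rev [Suc j..<Suc (n - 1)] @ [1..<Suc j]"
          using Cons.IH[of "n - 1"] by blast
        \<comment> \<open>Prepending \<open>n\<close> lengthens the decreasing run by one and leaves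
          \<open>j\<close> unchanged.\<close>
        then have "x # xs = rev [Suc j..<Suc n] @ [1..<Suc j]"
          using \<open>x = n\<close> by (cases n) auto
        then show ?thesis using j(1) by (intro image_eqI[of _ _ j]) auto
      qed
    next
      case False
      then obtain y ys where xs: "xs = y # ys" by (cases xs) auto
      then have "x < y"
        using False rel perm(2) by (auto simp: order_le_less)
      then have gt: "\<forall>z\<in>set xs. x < z" using rel xs by auto
      have "sorted xs"
        using rel by (rule sorted_wrt_mono_rel[rotated]) (use gt in fastforce)
      then have "x # xs = [1..<Suc n]"
        using gt perm by (intro sorted_distinct_set_unique) (auto simp del: upt_Suc)
      \<comment> \<open>The identity is the case \<open>j = n\<close>, where the decreasing run
        before the letter 1 is empty.\<close>
      then show ?thesis
        using Cons.prems(3) by (intro image_eqI[of _ _ n]) auto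
    qed
  qed
qed

text \<open>The first letter \<open>x\<close> determines the word: the later letters below
  \<open>x\<close> decrease by 312, those above it increase by 132, and by 231 no smaller one
  follows a larger one.\<close>

lemma avoids_132_231_312_iff:
  assumes "\<pi> \<in> permutations_of_set {1..n}" "n \<ge> 1"
  shows "(\<forall>\<rho>\<in>{[1,3,2], [2,3,1], [3,1,2]}. avoids \<pi> \<rho>) \<longleftrightarrow>
    \<pi> \<in> (\<lambda>k. rev [1..<Suc k] @ [Suc k..<Suc n]) ` {1..n}"
proof
  assume "\<pi> \<in> (\<lambda>k. rev [1..<Suc k] @ [Suc k..<Suc n]) ` {1..n}"
  then obtain k where k: "k \<in> {1..n}" "\<pi> = rev [1..<Suc k] @ [Suc k..<Suc n]" by blast
  have "\<pi> ! i = (if i < k then k - i else Suc i)" if "i < n" for i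
    using that k by (auto simp: nth_append rev_nth simp del: upt_Suc)
  then have "\<not> (\<pi> ! i < \<pi> ! l \<and> \<pi> ! l < \<pi> ! j)" "\<not> (\<pi> ! l < \<pi> ! i \<and> \<pi> ! i < \<pi> ! j)"
    "\<not> (\<pi> ! j < \<pi> ! l \<and> \<pi> ! l < \<pi> ! i)" if "i < j" "j < l" "l < n" for i j l
    using that by auto
  moreover have "length \<pi> = n" using k by simp
  ultimately show "\<forall>\<rho>\<in>{[1,3,2], [2,3,1], [3,1,2]}. avoids \<pi> \<rho>"
    by (auto simp: avoids_def contains_pattern_3 not_le)
next
  assume avoid: "\<forall>\<rho>\<in>{[1,3,2], [2,3,1], [3,1,2]}. avoids \<pi> \<rho>"
  obtain x xs where x: "\<pi> = x # xs"
    using assms by (cases \<pi>) (auto simp: permutations_of_set_def)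
  have perm: "insert x (set xs) = {1..n}" "x \<notin> set xs" "distinct xs"
    using assms x by (auto simp: permutations_of_set_def)
  \<comment> \<open>Avoidance at the first letter \<open>x\<close> says that the rest of the word is sorted by this key.\<close>
  define key where "key y = (if y < x then - int y else int y)" for y
  have "inj key"
    by (auto simp: inj_def key_def split: if_splits)
  have "sorted_wrt (\<lambda>y z. \<not> (x < z \<and> z < y)) xs"
    "sorted_wrt (\<lambda>y z. \<not> (z < x \<and> x < y)) xs"
    "sorted_wrt (\<lambda>y z. \<not> (y < z \<and> z < x)) xs"
    using avoid unfolding x by (blast intro: avoids_132_Cons avoids_231_Cons avoids_312_Cons)+
  note rel = this[THEN sorted_wrt_nth_less]
  have "key (xs ! i) \<le> key (xs ! j)" if ij: "i < j" "j < length xs" for i j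
  proof -
    have "xs ! i \<noteq> x" "xs ! j \<noteq> x" using perm(2) ij by auto
    then show ?thesis
      using rel(1)[OF ij] rel(2)[OF ij] rel(3)[OF ij] unfolding key_def by auto
  qed
  then have sorted_key: "sorted (map key xs)"
    by (simp add: sorted_map sorted_wrt_iff_nth_less)
  let ?zs = "rev [1..<x] @ [Suc x..<Suc n]"
  have "x \<in> {1..n}" using perm(1) by blast
  \<comment> \<open>Both key lists are sorted and distinct with the same set, hence equal;
    injectivity of \<open>key\<close> then carries this back to the words.\<close>
  have "map key xs = map key ?zs"
  proof (rule sorted_distinct_set_unique[OF sorted_key])
    show "sorted (map key ?zs)"
      by (auto simp: sorted_append sorted_map sorted_wrt_append sorted_wrt_rev key_def
          intro!: sorted_wrt_mono_rel[OF _ sorted_wrt_upt] simp del: upt_Suc)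
    show "distinct (map key xs)" "distinct (map key ?zs)"
      using perm(3) \<open>inj key\<close>
      by (auto simp: distinct_map intro: inj_on_subset simp del: upt_Suc map_append)
    have "set xs = {1..n} - {x}" using perm(1,2) by (metis Diff_insert_absorb)
    also have "\<dots> = set ?zs" using \<open>x \<in> {1..n}\<close> by (auto simp del: upt_Suc)
    finally have "set xs = set ?zs" .
    then show "set (map key xs) = set (map key ?zs)" by (simp only: set_map)
  qed
  then have "xs = ?zs" using \<open>inj key\<close> by (simp only: inj_map_eq_map)
  then have "\<pi> = rev [1..<Suc x] @ [Suc x..<Suc n]"
    using x \<open>x \<in> {1..n}\<close> by simp
  then show "\<pi> \<in> (\<lambda>k. rev [1..<Suc k] @ [Suc k..<Suc n]) ` {1..n}"
    using \<open>x \<in> {1..n}\<close> by blast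
qed

theorem theorem12:
  fixes n :: nat
  assumes "n \<ge> 1"
  shows "real (pf n {[1,3,2], [2,1,3], [2,3,1]}) = (\<Sum>i=1..n. catalan i) \<and>
         real (pf n {[1,3,2], [2,3,1], [3,1,2]}) = (\<Sum>i=1..n. catalan i)"
proof
  show "real (pf n {[1,3,2], [2,1,3], [2,3,1]}) = (\<Sum>i=1..n. catalan i)"
  proof (rule pf_eq_sum_catalan[OF avoids_132_213_231_iff])
    show "inj_on (\<lambda>j. rev [Suc j..<Suc n] @ [1..<Suc j]) {1..n}"
      \<comment> \<open>The last letter of the word is \<open>j\<close>.\<close>
      by (rule inj_on_inverseI[where g = last]) simp
    fix j assume j: "j \<in> {1..n}"
    then show "rev [Suc j..<Suc n] @ [1..<Suc j] \<in> permutations_of_set {1..n}"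
      by (auto simp: permutations_of_set_def simp del: upt_Suc)
    have "[1..<Suc j] = 1 # [2..<Suc j]"
      using j by (simp add: upt_conv_Cons numeral_2_eq_2 del: upt_Suc)
    then show "finite (labelled_paths 0 (rev [Suc j..<Suc n] @ [1..<Suc j])) \<and>
      real (card (labelled_paths 0 (rev [Suc j..<Suc n] @ [1..<Suc j]))) = catalan j"
      using card_labelled_paths_valley[of "rev [Suc j..<Suc n]" 1 "[2..<Suc j]"] j
      by (simp add: sorted_wrt_append sorted_wrt_rev del: upt_Suc)
  qed (use assms in auto)
  have "real (pf n {[1,3,2], [2,3,1], [3,1,2]}) = (\<Sum>k=1..n. catalan (Suc n - k))"
  proof (rule pf_eq_sum_catalan[OF avoids_132_231_312_iff])
    show "inj_on (\<lambda>k. rev [1..<Suc k] @ [Suc k..<Suc n]) {1..n}"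
      \<comment> \<open>The first letter of the word is \<open>k\<close>.\<close>
      by (rule inj_on_inverseI[where g = hd]) simp
    fix k assume k: "k \<in> {1..n}"
    then show "rev [1..<Suc k] @ [Suc k..<Suc n] \<in> permutations_of_set {1..n}"
      by (auto simp: permutations_of_set_def simp del: upt_Suc)
    \<comment> \<open>The letter 1 is split off as the bottom of the valley. It counts towards the
      increasing part 1, k+1, ..., n, whose n - k + 1 letters give the Catalan index.\<close>
    have "[1..<Suc k] = 1 # [2..<Suc k]"
      using k by (simp add: upt_conv_Cons numeral_2_eq_2 del: upt_Suc)
    then show "finite (labelled_paths 0 (rev [1..<Suc k] @ [Suc k..<Suc n])) \<and>
      real (card (labelled_paths 0 (rev [1..<Suc k] @ [Suc k..<Suc n]))) = catalan (Suc n - k)"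
      using card_labelled_paths_valley[of "rev [2..<Suc k]" 1 "[Suc k..<Suc n]"] k
      by (simp add: sorted_wrt_append sorted_wrt_rev Suc_diff_le del: upt_Suc)
  qed (use assms in auto)
  then show "real (pf n {[1,3,2], [2,3,1], [3,1,2]}) = (\<Sum>i=1..n. catalan i)"
    by (simp add: sum.atLeastAtMost_rev[of catalan])
qed

end
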